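(* Let $n$ be a positive integer, let $G=I_2(n)$, and let $C=\bigcup_i C_i$ be a union of conjugacy classes of $G$. Then the conjugation quandle $\mathrm{Conj}(G,C)$ satisfies the Hayashi property.
   Context: $I_2(n)$ denotes the Coxeter group isomorphic to the dihedral group of order $2n$, with presentation $\langle r,s\mid r^n=1,\ s^2=1,\ srs^{-1}=r^{-1}\rangle$. For a group $G$ and a conjugation-closed subset $C\subseteq G$, the conjugation quandle $\mathrm{Conj}(G,C)$ is the set $C$ with the binary operation $x\triangleright y=yxy^{-1}$. For $y\in C$ the right translation is the permutation $R_y:C\to C$, $R_y(x)=x\triangleright y=yxy^{-1}$. A permutation of a finite set whose disjoint cycles (fixed points included as cycles of length $1$) have the distinct lengths $\lambda_1<\lambda_2<\dots<\lambda_t$ is called regular if $\lambda_i$ divides $\lambda_t$ for all $1\le i\le t$. A finite quandle satisfies the Hayashi property if all of its right translations are regular permutations. *)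

theory Defs
  imports "HOL-Algebra.Coset" "HOL-Combinatorics.Orbits"
begin

section \<open>Groups given by generators and relations\<close>

text \<open>The letter \<open>(a, True)\<close> stands for the generator \<open>a\<close>, and \<open>(a, False)\<close> for its formal
  inverse. A pair of words \<open>(p, q)\<close> is read as the relation \<open>p = q\<close>.\<close>

type_synonym 'g word = "('g \<times> bool) list"

inductive pres_eq :: "('g word \<times> 'g word) set \<Rightarrow> 'g word \<Rightarrow> 'g word \<Rightarrow> bool"
  for R where
  pres_refl: "pres_eq R u u"
| pres_sym: "pres_eq R u v \<Longrightarrow> pres_eq R v u"
| pres_trans: "pres_eq R u v \<Longrightarrow> pres_eq R v w \<Longrightarrow> pres_eq R u w"
| pres_cancel: "pres_eq R (u @ [(a, b), (a, \<not> b)] @ v) (u @ v)"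
| pres_rel: "(p, q) \<in> R \<Longrightarrow> pres_eq R (u @ p @ v) (u @ q @ v)"

definition pres_class :: "('g word \<times> 'g word) set \<Rightarrow> 'g word \<Rightarrow> 'g word set" where
  "pres_class R u = {v. pres_eq R u v}"

definition presented_group :: "('g word \<times> 'g word) set \<Rightarrow> 'g word set monoid" where
  "presented_group R =
     \<lparr> carrier = range (pres_class R),
       monoid.mult = (\<lambda>A B. {w. \<exists>u\<in>A. \<exists>v\<in>B. pres_eq R (u @ v) w}),
       monoid.one = pres_class R [] \<rparr>"

lemma pres_eq_append_left: "pres_eq R u v \<Longrightarrow> pres_eq R (w @ u) (w @ v)"
proof (induction rule: pres_eq.induct)
  case (pres_cancel u a b v)
  then show ?case using pres_eq.pres_cancel[of R "w @ u" a b v] by simp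
next
  case (pres_rel p q u v)
  then show ?case using pres_eq.pres_rel[of p q R "w @ u" v] by simp
qed (blast intro: pres_eq.intros)+

lemma pres_eq_append_right: "pres_eq R u v \<Longrightarrow> pres_eq R (u @ w) (v @ w)"
proof (induction rule: pres_eq.induct)
  case (pres_cancel u a b v)
  then show ?case using pres_eq.pres_cancel[of R u a b "v @ w"] by simp
next
  case (pres_rel p q u v)
  then show ?case using pres_eq.pres_rel[of p q R u "v @ w"] by simp
qed (blast intro: pres_eq.intros)+

lemma pres_eq_append:
  "pres_eq R u u' \<Longrightarrow> pres_eq R v v' \<Longrightarrow> pres_eq R (u @ v) (u' @ v')"
  by (meson pres_eq_append_left pres_eq_append_right pres_trans)

lemma pres_class_eq_iff: "pres_class R u = pres_class R v \<longleftrightarrow> pres_eq R u v"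
  unfolding pres_class_def by (auto intro: pres_eq.intros)

lemma presented_group_mult:
  "pres_class R u \<otimes>\<^bsub>presented_group R\<^esub> pres_class R v = pres_class R (u @ v)"
proof -
  have "(\<exists>u'. pres_eq R u u' \<and> (\<exists>v'. pres_eq R v v' \<and> pres_eq R (u' @ v') w))
      \<longleftrightarrow> pres_eq R (u @ v) w" for w
    by (meson pres_eq_append pres_refl pres_trans)
  then show ?thesis by (auto simp: presented_group_def pres_class_def)
qed

lemma presented_group_one: "\<one>\<^bsub>presented_group R\<^esub> = pres_class R []"
  by (simp add: presented_group_def)

lemma presented_group_carrier: "carrier (presented_group R) = range (pres_class R)"
  by (simp add: presented_group_def)

lemma pres_eq_inverse: "\<exists>v. pres_eq R (v @ u) []"
proof (induction u)
  case Nil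
  then show ?case by (metis append_Nil pres_refl)
next
  case (Cons x u)
  then obtain v where v: "pres_eq R (v @ u) []" by blast
  obtain a b where x: "x = (a, b)" by (cases x)
  have "pres_eq R (v @ [(a, \<not> b), (a, \<not> \<not> b)] @ u) (v @ u)"
    by (rule pres_cancel)
  then have "pres_eq R ((v @ [(a, \<not> b)]) @ x # u) []"
    using v x by (auto intro: pres_trans)
  then show ?case by blast
qed

lemma group_presented_group: "group (presented_group R)"
proof (rule groupI)
  fix x assume "x \<in> carrier (presented_group R)"
  then obtain u where u: "x = pres_class R u" by (auto simp: presented_group_carrier)
  obtain v where "pres_eq R (v @ u) []" using pres_eq_inverse by blast
  then show "\<exists>y\<in>carrier (presented_group R).
      y \<otimes>\<^bsub>presented_group R\<^esub> x = \<one>\<^bsub>presented_group R\<^esub>"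
    unfolding u presented_group_carrier
    by (auto simp: presented_group_mult presented_group_one pres_class_eq_iff)
qed (auto simp: presented_group_carrier presented_group_mult presented_group_one)


section \<open>The dihedral Coxeter group\<close>

datatype I2_gen = gen_r | gen_s

definition I2_relations :: "nat \<Rightarrow> (I2_gen word \<times> I2_gen word) set" where
  "I2_relations n =
     {(replicate n (gen_r, True), []),
      ([(gen_s, True), (gen_s, True)], []),
      ([(gen_s, True), (gen_r, True), (gen_s, False)], [(gen_r, False)])}"

definition I2 :: "nat \<Rightarrow> I2_gen word set monoid" where
  "I2 n = presented_group (I2_relations n)"

lemma group_I2: "group (I2 n)"
  by (simp add: I2_def group_presented_group)

text \<open>The presentation does not collapse: \<open>I2 n\<close> has order \<open>2 * n\<close>. Words are evaluated to pairs
  \<open>(k, b)\<close> standing for \<open>r^k s^b\<close>.\<close>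

fun I2_eval :: "I2_gen word \<Rightarrow> int \<times> bool" where
  "I2_eval [] = (0, False)"
| "I2_eval ((gen_r, e) # w) = ((if e then 1 else - 1) + fst (I2_eval w), snd (I2_eval w))"
| "I2_eval ((gen_s, e) # w) = (- fst (I2_eval w), \<not> snd (I2_eval w))"

lemma I2_eval_append:
  "I2_eval (u @ v) =
     (fst (I2_eval u) + (if snd (I2_eval u) then - fst (I2_eval v) else fst (I2_eval v)),
      snd (I2_eval u) \<noteq> snd (I2_eval v))"
  by (induction u rule: I2_eval.induct) auto

lemma I2_eval_replicate: "I2_eval (replicate k (gen_r, True)) = (int k, False)"
  by (induction k) auto

lemma I2_eval_cong:
  "pres_eq (I2_relations n) u v \<Longrightarrow>
     int n dvd fst (I2_eval u) - fst (I2_eval v) \<and> snd (I2_eval u) = snd (I2_eval v)"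
proof (induction rule: pres_eq.induct)
  case (pres_sym u v)
  then show ?case by (metis dvd_diff_commute)
next
  case (pres_trans u v w)
  have "fst (I2_eval u) - fst (I2_eval w) =
      (fst (I2_eval u) - fst (I2_eval v)) + (fst (I2_eval v) - fst (I2_eval w))"
    by simp
  with pres_trans.IH show ?case by (metis dvd_add)
next
  case (pres_cancel u a b v)
  then show ?case by (cases a) (auto simp: I2_eval_append)
next
  case (pres_rel p q u v)
  then show ?case by (auto simp: I2_relations_def I2_eval_append I2_eval_replicate)
qed auto

definition I2_normal :: "nat \<Rightarrow> bool \<Rightarrow> I2_gen word" where
  "I2_normal k b = replicate k (gen_r, True) @ (if b then [(gen_s, True)] else [])"

lemma I2_eval_normal: "I2_eval (I2_normal k b) = (int k, b)"
  by (auto simp: I2_normal_def I2_eval_append I2_eval_replicate)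

lemma I2_cancel: "pres_eq (I2_relations n) ((a, b) # (a, \<not> b) # v) v"
  using pres_cancel[of _ "[]"] by simp

lemma I2_S_S: "pres_eq (I2_relations n) ((gen_s, True) # (gen_s, True) # v) v"
  using pres_rel[of "[(gen_s, True), (gen_s, True)]" "[]" "I2_relations n" "[]" v]
  by (simp add: I2_relations_def)

lemma I2_R_power: "pres_eq (I2_relations n) (replicate n (gen_r, True) @ v) v"
  using pres_rel[of "replicate n (gen_r, True)" "[]" "I2_relations n" "[]" v]
  by (simp add: I2_relations_def)

lemma pres_eq_Cons: "pres_eq Q u v \<Longrightarrow> pres_eq Q (x # u) (x # v)"
  using pres_eq_append_left[of Q u v "[x]"] by simp

lemma I2_inv_S: "pres_eq (I2_relations n) ((gen_s, False) # v) ((gen_s, True) # v)"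
proof -
  have "pres_eq (I2_relations n) ((gen_s, False) # (gen_s, True) # (gen_s, True) # v) ((gen_s, False) # v)"
    by (intro pres_eq_Cons I2_S_S)
  moreover have "pres_eq (I2_relations n) ((gen_s, False) # (gen_s, True) # (gen_s, True) # v) ((gen_s, True) # v)"
    using I2_cancel[of n gen_s False] by simp
  ultimately show ?thesis by (meson pres_eq.intros)
qed

lemma I2_inv_R:
  assumes "n > 0"
  shows "pres_eq (I2_relations n) ((gen_r, False) # v) (replicate (n - 1) (gen_r, True) @ v)"
proof -
  obtain m where m: "n = Suc m" using assms gr0_conv_Suc by blast
  have "pres_eq (I2_relations n) ((gen_r, False) # replicate n (gen_r, True) @ v) ((gen_r, False) # v)"
    by (intro pres_eq_Cons I2_R_power)
  moreover have "pres_eq (I2_relations n) ((gen_r, False) # replicate n (gen_r, True) @ v)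
      (replicate (n - 1) (gen_r, True) @ v)"
    using I2_cancel[of n gen_r False] m by simp
  ultimately show ?thesis by (meson pres_eq.intros)
qed

lemma I2_S_R: "pres_eq (I2_relations n) ((gen_s, True) # (gen_r, True) # v) ((gen_r, False) # (gen_s, True) # v)"
proof -
  have "pres_eq (I2_relations n) ((gen_s, True) # (gen_r, True) # (gen_s, False) # (gen_s, True) # v)
      ((gen_r, False) # (gen_s, True) # v)"
    using pres_rel[of "[(gen_s, True), (gen_r, True), (gen_s, False)]" "[(gen_r, False)]"
        "I2_relations n" "[]" "(gen_s, True) # v"]
    by (simp add: I2_relations_def)
  moreover have "pres_eq (I2_relations n) ((gen_s, True) # (gen_r, True) # (gen_s, False) # (gen_s, True) # v)
      ((gen_s, True) # (gen_r, True) # v)"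
    using I2_cancel[of n gen_s False] by (intro pres_eq_Cons) simp
  ultimately show ?thesis by (meson pres_eq.intros)
qed

lemma I2_normal_less:
  assumes "n > 0"
  shows "\<exists>j<n. pres_eq (I2_relations n) (I2_normal k b) (I2_normal j b)"
proof (induction k rule: less_induct)
  case (less k)
  show ?case
  proof (cases "k < n")
    case True
    then show ?thesis using pres_refl by blast
  next
    case False
    then have "I2_normal k b = replicate n (gen_r, True) @ I2_normal (k - n) b"
      by (simp add: I2_normal_def flip: replicate_add append_assoc)
    then have "pres_eq (I2_relations n) (I2_normal k b) (I2_normal (k - n) b)"
      using I2_R_power by simp
    then show ?thesis using less[of "k - n"] False assms
      by (metis diff_less not_less order_less_le_trans pres_trans)
  qed
qed

lemma I2_S_normal:
  assumes "n > 0"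
  shows "\<exists>j. pres_eq (I2_relations n) ((gen_s, True) # I2_normal k b) (I2_normal j (\<not> b))"
proof (induction k)
  case 0
  show ?case
    using I2_S_S[of n "[]"] pres_refl[of _ "[(gen_s, True)]"]
    by (intro exI[of _ 0]) (simp add: I2_normal_def)
next
  case (Suc k)
  then obtain j where j: "pres_eq (I2_relations n) ((gen_s, True) # I2_normal k b) (I2_normal j (\<not> b))"
    by blast
  have "pres_eq (I2_relations n) ((gen_s, True) # I2_normal (Suc k) b)
      ((gen_r, False) # (gen_s, True) # I2_normal k b)"
    using I2_S_R by (simp add: I2_normal_def)
  moreover have "pres_eq (I2_relations n) ((gen_r, False) # (gen_s, True) # I2_normal k b)
      (replicate (n - 1) (gen_r, True) @ (gen_s, True) # I2_normal k b)"
    by (rule I2_inv_R[OF assms])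
  moreover have "pres_eq (I2_relations n) (replicate (n - 1) (gen_r, True) @ (gen_s, True) # I2_normal k b)
      (replicate (n - 1) (gen_r, True) @ I2_normal j (\<not> b))"
    by (rule pres_eq_append_left[OF j])
  moreover have "replicate (n - 1) (gen_r, True) @ I2_normal j (\<not> b) = I2_normal (n - 1 + j) (\<not> b)"
    by (simp add: I2_normal_def replicate_add)
  ultimately show ?case by (metis pres_trans)
qed

lemma I2_normal_form:
  assumes "n > 0"
  shows "\<exists>k b. pres_eq (I2_relations n) w (I2_normal k b)"
proof (induction w)
  case Nil
  have "[] = I2_normal 0 False" by (simp add: I2_normal_def)
  then show ?case by (metis pres_refl)
next
  case (Cons x w)
  then obtain k b where w: "pres_eq (I2_relations n) w (I2_normal k b)" by blast
  obtain a e where x: "x = (a, e)" by (cases x)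
  have xw: "pres_eq (I2_relations n) (x # w) (x # I2_normal k b)"
    by (rule pres_eq_Cons[OF w])
  have "\<exists>k' b'. pres_eq (I2_relations n) (x # I2_normal k b) (I2_normal k' b')"
  proof (cases a)
    case gen_r
    show ?thesis
    proof (cases e)
      case True
      then have "x # I2_normal k b = I2_normal (Suc k) b"
        using x gen_r by (simp add: I2_normal_def)
      then show ?thesis by (metis pres_refl)
    next
      case False
      have "replicate (n - 1) (gen_r, True) @ I2_normal k b = I2_normal (n - 1 + k) b"
        by (simp add: I2_normal_def replicate_add)
      then show ?thesis using I2_inv_R[OF assms, of "I2_normal k b"] x gen_r False by auto
    qed
  next
    case gen_s
    have "pres_eq (I2_relations n) (x # I2_normal k b) ((gen_s, True) # I2_normal k b)"
      using x gen_s I2_inv_S by (cases e) (auto intro: pres_refl)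
    then show ?thesis using I2_S_normal[OF assms, of k b] by (meson pres_trans)
  qed
  then show ?case using xw by (meson pres_trans)
qed

lemma order_I2:
  assumes "n > 0"
  shows "order (I2 n) = 2 * n"
proof -
  let ?f = "\<lambda>(k, b). pres_class (I2_relations n) (I2_normal k b)"
  have "inj_on ?f ({..<n} \<times> UNIV)"
  proof (intro inj_onI, clarify)
    fix k b l c
    assume kl: "k < n" "l < n"
      and "pres_class (I2_relations n) (I2_normal k b) = pres_class (I2_relations n) (I2_normal l c)"
    then have "int n dvd int k - int l" "b = c"
      using I2_eval_cong[of n "I2_normal k b" "I2_normal l c"]
      by (auto simp: pres_class_eq_iff I2_eval_normal)
    then show "k = l \<and> b = c"
      using kl by (auto simp: mod_eq_dvd_iff[symmetric] simp flip: of_nat_mod)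
  qed
  moreover have "?f ` ({..<n} \<times> UNIV) = carrier (I2 n)"
  proof -
    have "\<exists>k<n. \<exists>b. pres_eq (I2_relations n) w (I2_normal k b)" for w
      by (meson I2_normal_form[OF assms] I2_normal_less[OF assms] pres_trans)
    then have "pres_class (I2_relations n) w \<in> ?f ` ({..<n} \<times> UNIV)" for w
      by (fastforce simp: pres_class_eq_iff image_iff)
    then show ?thesis by (auto simp: I2_def presented_group_carrier)
  qed
  ultimately have "card (carrier (I2 n)) = card ({..<n} \<times> (UNIV :: bool set))"
    using card_image by metis
  then show ?thesis by (simp add: order_def card_cartesian_product)
qed


section \<open>Conjugation quandles\<close>

record 'a quandle_struct = "'a partial_object" +
  qop :: "'a \<Rightarrow> 'a \<Rightarrow> 'a" (infixl \<open>\<triangleright>\<index>\<close> 70)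

locale quandle =
  fixes Q :: "('a, 'm) quandle_struct_scheme" (structure)
  assumes q_closed: "x \<in> carrier Q \<Longrightarrow> y \<in> carrier Q \<Longrightarrow> x \<triangleright> y \<in> carrier Q"
    and q_idem: "x \<in> carrier Q \<Longrightarrow> x \<triangleright> x = x"
    and q_bij: "y \<in> carrier Q \<Longrightarrow> bij_betw (\<lambda>x. x \<triangleright> y) (carrier Q) (carrier Q)"
    and q_distrib: "x \<in> carrier Q \<Longrightarrow> y \<in> carrier Q \<Longrightarrow> z \<in> carrier Q \<Longrightarrow>
      (x \<triangleright> y) \<triangleright> z = (x \<triangleright> z) \<triangleright> (y \<triangleright> z)"

definition conjugacy_class :: "('a, 'm) monoid_scheme \<Rightarrow> 'a \<Rightarrow> 'a set" where
  "conjugacy_class G x = {g \<otimes>\<^bsub>G\<^esub> x \<otimes>\<^bsub>G\<^esub> inv\<^bsub>G\<^esub> g | g. g \<in> carrier G}"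

definition conjugacy_classes :: "('a, 'm) monoid_scheme \<Rightarrow> 'a set set" where
  "conjugacy_classes G = conjugacy_class G ` carrier G"

definition Conj :: "('a, 'm) monoid_scheme \<Rightarrow> 'a set \<Rightarrow> 'a quandle_struct" where
  "Conj G C = \<lparr> carrier = C, qop = (\<lambda>x y. y \<otimes>\<^bsub>G\<^esub> x \<otimes>\<^bsub>G\<^esub> inv\<^bsub>G\<^esub> y) \<rparr>"

text \<open>Extended by the identity outside the carrier, as \<open>permutes\<close> requires.\<close>

definition right_translation :: "('a, 'm) quandle_struct_scheme \<Rightarrow> 'a \<Rightarrow> 'a \<Rightarrow> 'a" where
  "right_translation Q y = (\<lambda>x. if x \<in> carrier Q then x \<triangleright>\<^bsub>Q\<^esub> y else x)"


section \<open>The Hayashi property\<close>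

text \<open>For a permutation \<open>f\<close> of a finite set, the orbit of \<open>x\<close> is the underlying set of the disjoint
  cycle through \<open>x\<close>; fixed points give orbits of size 1.\<close>

definition cycle_lengths :: "'a set \<Rightarrow> ('a \<Rightarrow> 'a) \<Rightarrow> nat set" where
  "cycle_lengths A f = (\<lambda>x. card (orbit f x)) ` A"

definition regular_permutation :: "'a set \<Rightarrow> ('a \<Rightarrow> 'a) \<Rightarrow> bool" where
  "regular_permutation A f \<longleftrightarrow> finite A \<and> f permutes A \<and>
     (\<forall>l\<in>cycle_lengths A f. l dvd Max (cycle_lengths A f))"

definition hayashi_property :: "('a, 'm) quandle_struct_scheme \<Rightarrow> bool" where
  "hayashi_property Q \<longleftrightarrow> quandle Q \<and> finite (carrier Q) \<and>
     (\<forall>y\<in>carrier Q. regular_permutation (carrier Q) (right_translation Q y))"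

end

theory Submission
  imports Defs
begin

text \<open>Conjugation by a reflection is an involution, so its cycles have length 1 or 2. A rotation
  \<open>y\<close> commutes with every rotation and satisfies \<open>y x y = x\<close> for every reflection \<open>x\<close>; hence
  \<open>y\<^sup>k x y\<^sup>-\<^sup>k = x\<close> iff \<open>y\<^sup>2\<^sup>k = 1\<close>, a condition that does not depend on \<open>x\<close>. Either way all
  nontrivial cycles of a right translation have the same length.\<close>

section \<open>Orbits and regularity of permutations\<close>

lemma orbit_fixpoint:
  assumes "f x = x"
  shows "orbit f x = {x}"
proof -
  have "z = x" if "z \<in> orbit f x" for z
    using that by induction (auto simp: assms)
  moreover have "x \<in> orbit f x"
    using orbit.base[of f x] assms by simp
  ultimately show ?thesis by auto
qed

lemma card_orbit_eq_funpow_dist1: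
  assumes "x \<in> orbit f x"
  shows "card (orbit f x) = funpow_dist1 f x x"
  using orbit_conv_funpow_dist1[OF assms] inj_on_funpow_dist1[OF assms]
  by (simp add: card_image)

text \<open>An orbit is as large as the first positive return time of its base point, so the set of
  return exponents determines its size.\<close>

lemma card_orbit_cong:
  assumes "x \<in> orbit f x" "z \<in> orbit f z"
    and "\<And>k. (f ^^ k) x = x \<longleftrightarrow> (f ^^ k) z = z"
  shows "card (orbit f x) = card (orbit f z)"
proof -
  \<comment> \<open>\<open>funpow_dist1\<close> is one plus the least \<open>k\<close> with
    \<open>(f ^^ k) (f x) = x\<close>, hence the shift to \<open>Suc k\<close>.\<close>
  have "(f ^^ k) (f x) = x \<longleftrightarrow> (f ^^ k) (f z) = z" for k
    using assms(3)[of "Suc k"] by (simp add: funpow_swap1)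
  then show ?thesis
    by (simp add: card_orbit_eq_funpow_dist1 assms funpow_dist_def)
qed

text \<open>One implication in \<open>period\<close> suffices, since \<open>x\<close> and
  \<open>z\<close> may be swapped. All moved points then share one orbit size, so the only cycle
  lengths are 1 and that size.\<close>

lemma regular_permutationI:
  assumes fin: "finite A" and perm: "f permutes A"
    and period: "\<And>x z k. x \<in> A \<Longrightarrow> z \<in> A \<Longrightarrow> f x \<noteq> x \<Longrightarrow> f z \<noteq> z \<Longrightarrow>
      (f ^^ k) x = x \<Longrightarrow> (f ^^ k) z = z"
  shows "regular_permutation A f"
proof -
  have self: "x \<in> orbit f x" for x
  proof (rule permutation_self_in_orbit)
    show "permutation f" using fin perm unfolding permutation_permutes by blast
  qed
  have eq: "card (orbit f x) = card (orbit f z)"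
    if "x \<in> A" "z \<in> A" "f x \<noteq> x" "f z \<noteq> z" for x z
    by (rule card_orbit_cong[OF self self]) (use period that in blast)
  have "l dvd m" if lm: "l \<in> cycle_lengths A f" "m \<in> cycle_lengths A f" "l \<le> m" for l m
  proof -
    obtain x z where x: "x \<in> A" "l = card (orbit f x)" and z: "z \<in> A" "m = card (orbit f z)"
      using lm by (auto simp: cycle_lengths_def)
    show ?thesis
    proof (cases "f x = x")
      case True
      then show ?thesis using x by (simp add: orbit_fixpoint)
    next
      case False
      have "card (orbit f x) > 0"
        by (simp add: card_orbit_eq_funpow_dist1[OF self])
      show ?thesis
      proof (cases "f z = z")
        \<comment> \<open>Here \<open>m = 1\<close>, so \<open>l \<le> m\<close> and positivity of
          \<open>l\<close> force \<open>l = 1\<close>.\<close>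
        case True
        then have "l = m"
          using lm(3) x z \<open>card (orbit f x) > 0\<close> by (simp add: orbit_fixpoint)
        then show ?thesis by simp
      next
        case False
        then show ?thesis using eq[of x z] x z \<open>f x \<noteq> x\<close> by simp
      qed
    qed
  qed
  moreover have "finite (cycle_lengths A f)"
    using fin by (simp add: cycle_lengths_def)
  \<comment> \<open>Take \<open>m\<close> to be the maximum. If there are no lengths,
    \<open>Max\<close> is unspecified but the claim is vacuous.\<close>
  ultimately have "\<forall>l\<in>cycle_lengths A f. l dvd Max (cycle_lengths A f)"
    using Max_ge Max_in by (metis empty_iff)
  then show ?thesis using fin perm by (simp add: regular_permutation_def)
qed

section \<open>Conjugation in an arbitrary group\<close>

context group
begin

lemma conj_conj:
  assumes "x \<in> carrier G" "y \<in> carrier G" "z \<in> carrier G"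
  shows "z \<otimes> (y \<otimes> x \<otimes> inv y) \<otimes> inv z = (z \<otimes> y) \<otimes> x \<otimes> inv (z \<otimes> y)"
  using assms by (simp add: m_assoc inv_mult_group)

lemma conj_eq_iff:
  assumes "x \<in> carrier G" "y \<in> carrier G"
  shows "y \<otimes> x \<otimes> inv y = x \<longleftrightarrow> y \<otimes> x = x \<otimes> y"
  using assms by (metis inv_solve_right' m_closed)

lemma conj_inv_cancel:
  assumes "x \<in> carrier G" "y \<in> carrier G"
  shows "y \<otimes> (inv y \<otimes> x \<otimes> y) \<otimes> inv y = x" "inv y \<otimes> (y \<otimes> x \<otimes> inv y) \<otimes> y = x"
  using assms conj_conj[of x "inv y" y] conj_conj[of x y "inv y"] by simp_all

lemma bij_betw_conj:
  assumes "C \<subseteq> carrier G" "y \<in> carrier G"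
    and closed: "\<And>g x. g \<in> carrier G \<Longrightarrow> x \<in> C \<Longrightarrow> g \<otimes> x \<otimes> inv g \<in> C"
  shows "bij_betw (\<lambda>x. y \<otimes> x \<otimes> inv y) C C"
proof (rule bij_betw_byWitness[where f' = "\<lambda>x. inv y \<otimes> x \<otimes> y"])
  show "(\<lambda>x. inv y \<otimes> x \<otimes> y) ` C \<subseteq> C"
    using closed[of "inv y"] assms(2) by auto
qed (use assms conj_inv_cancel in auto)

lemma quandle_Conj:
  assumes C: "C \<subseteq> carrier G"
    and closed: "\<And>g x. g \<in> carrier G \<Longrightarrow> x \<in> C \<Longrightarrow> g \<otimes> x \<otimes> inv g \<in> C"
  shows "quandle (Conj G C)"
proof
  fix x y z assume "x \<in> carrier (Conj G C)" "y \<in> carrier (Conj G C)" "z \<in> carrier (Conj G C)"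
  then have xyz: "x \<in> carrier G" "y \<in> carrier G" "z \<in> carrier G"
    using C by (auto simp: Conj_def)
  \<comment> \<open>Both sides reduce to the conjugate of \<open>x\<close> by
    \<open>z \<otimes> y\<close>.\<close>
  have "z \<otimes> (y \<otimes> x \<otimes> inv y) \<otimes> inv z
      = (z \<otimes> y \<otimes> inv z) \<otimes> (z \<otimes> x \<otimes> inv z) \<otimes> inv (z \<otimes> y \<otimes> inv z)"
    using xyz by (simp add: conj_conj m_assoc inv_mult_group)
      (simp add: inv_solve_left' flip: m_assoc)
  then show "(x \<triangleright>\<^bsub>Conj G C\<^esub> y) \<triangleright>\<^bsub>Conj G C\<^esub> z
      = (x \<triangleright>\<^bsub>Conj G C\<^esub> z) \<triangleright>\<^bsub>Conj G C\<^esub> (y \<triangleright>\<^bsub>Conj G C\<^esub> z)"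
    by (simp add: Conj_def)
next
  fix x assume "x \<in> carrier (Conj G C)"
  then show "x \<triangleright>\<^bsub>Conj G C\<^esub> x = x"
    using C by (auto simp: Conj_def conj_eq_iff subset_iff)
qed (use C closed bij_betw_conj in \<open>auto simp: Conj_def subset_iff\<close>)

text \<open>The relation passes to powers: \<open>p \<otimes> x \<otimes> p = x\<close> for
  \<open>p = y [^] k\<close>. Multiplying \<open>p \<otimes> x = x \<otimes> p\<close> by
  \<open>p\<close> on the right and cancelling \<open>x\<close> leaves a condition free of
  \<open>x\<close>.\<close>

lemma conj_pow_eq_iff:
  assumes x: "x \<in> carrier G" and y: "y \<in> carrier G" and "y \<otimes> x \<otimes> y = x"
  shows "y [^] (k::nat) \<otimes> x \<otimes> inv (y [^] k) = x \<longleftrightarrow> y [^] k \<otimes> y [^] k = \<one>"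
proof -
  have pow: "y [^] k \<otimes> x \<otimes> y [^] k = x" for k :: nat
  proof (induction k)
    case (Suc k)
    have "y [^] Suc k \<otimes> x \<otimes> y [^] Suc k = y [^] k \<otimes> (y \<otimes> x \<otimes> y) \<otimes> y [^] k"
      using x y by (metis m_assoc m_closed nat_pow_Suc nat_pow_Suc2 nat_pow_closed)
    then show ?case using Suc assms(3) by simp
  qed (use x in simp)
  let ?p = "y [^] k"
  have p: "?p \<in> carrier G" using y by simp
  have "?p \<otimes> x \<otimes> inv ?p = x \<longleftrightarrow> ?p \<otimes> x = x \<otimes> ?p"
    using x p by (rule conj_eq_iff)
  also have "\<dots> \<longleftrightarrow> ?p \<otimes> x \<otimes> ?p = x \<otimes> ?p \<otimes> ?p"
    using x p by simp
  also have "\<dots> \<longleftrightarrow> x = x \<otimes> (?p \<otimes> ?p)"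
    using x p by (simp add: pow m_assoc)
  also have "\<dots> \<longleftrightarrow> ?p \<otimes> ?p = \<one>"
    using x p by simp
  finally show ?thesis .
qed

text \<open>\<open>dichotomy\<close> is the reflection/rotation split in purely group-theoretic
  form. In either case the return exponents of the moved points agree.\<close>

lemma regular_right_translation:
  assumes C: "C \<subseteq> carrier G" "finite C"
    and closed: "\<And>g x. g \<in> carrier G \<Longrightarrow> x \<in> C \<Longrightarrow> g \<otimes> x \<otimes> inv g \<in> C"
    and y: "y \<in> carrier G"
    and dichotomy: "y \<otimes> y = \<one> \<or> (\<forall>x\<in>C. x \<otimes> y = y \<otimes> x \<or> y \<otimes> x \<otimes> y = x)"
  shows "regular_permutation C (right_translation (Conj G C) y)"
    (is "regular_permutation C ?f")
proof (rule regular_permutationI)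
  have f: "?f x = y \<otimes> x \<otimes> inv y" if "x \<in> C" for x
    using that by (simp add: right_translation_def Conj_def)
  \<comment> \<open>Membership in \<open>C\<close> is carried through the induction because
    \<open>?f\<close> is conjugation only on \<open>C\<close> and the identity elsewhere.\<close>
  have fk: "(?f ^^ k) x = y [^] k \<otimes> x \<otimes> inv (y [^] k) \<and> (?f ^^ k) x \<in> C"
    if x: "x \<in> C" for k x
  proof (induction k)
    case 0
    then show ?case using x C by auto
  next
    case (Suc k)
    then have "(?f ^^ Suc k) x = y \<otimes> (y [^] k \<otimes> x \<otimes> inv (y [^] k)) \<otimes> inv y"
      using f by auto
    also have "\<dots> = y [^] Suc k \<otimes> x \<otimes> inv (y [^] Suc k)"
      using x C y conj_conj[of x "y [^] k" y] nat_pow_Suc2[OF y, of k] by (simp add: subset_iff)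
    finally show ?case using closed x y by simp
  qed
  have "bij_betw ?f C C"
    using bij_betw_conj[OF C(1) y closed] f by (simp cong: bij_betw_cong)
  then show "?f permutes C"
    by (rule bij_imp_permutes) (simp add: right_translation_def Conj_def)
  fix x z k
  assume x: "x \<in> C" "?f x \<noteq> x" and z: "z \<in> C" "?f z \<noteq> z" and per: "(?f ^^ k) x = x"
  have xz: "x \<in> carrier G" "z \<in> carrier G" using x z C by auto
  show "(?f ^^ k) z = z"
  proof (cases "y \<otimes> y = \<one>")
    case True
    have inv: "?f (?f w) = w" if "w \<in> C" for w
      using fk[OF that, of 2] True that C y by (auto simp: numeral_2_eq_2)
    have fk': "(?f ^^ k) w = (if even k then w else ?f w)" if "w \<in> C" for w
      using that by (induction k) (auto simp: inv)
    \<comment> \<open>A moved \<open>x\<close> returns only at even \<open>k\<close>, and then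
      \<open>z\<close> returns too.\<close>
    show ?thesis using per x z fk' by (metis (full_types))
  next
    case False
    \<comment> \<open>A moved point does not commute with \<open>y\<close>, which leaves the second
      alternative of \<open>dichotomy\<close>.\<close>
    have "y \<otimes> w \<otimes> y = w" if "w \<in> C" "?f w \<noteq> w" for w
      using that dichotomy False f[of w] conj_eq_iff[of w y] C(1) y by (metis subsetD)
    then have "y \<otimes> x \<otimes> y = x" "y \<otimes> z \<otimes> y = z"
      using x z by auto
    then show ?thesis
      using per fk x z xz y by (simp add: conj_pow_eq_iff)
  qed
qed (rule C)

lemma conj_mem_conjugacy_class:
  assumes "a \<in> carrier G" "g \<in> carrier G" "x \<in> conjugacy_class G a"
  shows "g \<otimes> x \<otimes> inv g \<in> conjugacy_class G a"
proof -
  obtain h where h: "h \<in> carrier G" "x = h \<otimes> a \<otimes> inv h"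
    using assms(3) by (auto simp: conjugacy_class_def)
  then have "g \<otimes> x \<otimes> inv g = (g \<otimes> h) \<otimes> a \<otimes> inv (g \<otimes> h)"
    using assms conj_conj by simp
  then show ?thesis using h assms(2) unfolding conjugacy_class_def by blast
qed

end

section \<open>Computing in the dihedral group\<close>

text \<open>Converse of \<open>I2_eval_cong\<close>: both words reduce to normal forms with exponent
  below \<open>n\<close>, where congruent exponents coincide. Identities in \<open>I2 n\<close> thus
  become integer arithmetic.\<close>

lemma I2_eval_complete:
  assumes n: "n > 0"
    and "int n dvd fst (I2_eval u) - fst (I2_eval v)" "snd (I2_eval u) = snd (I2_eval v)"
  shows "pres_eq (I2_relations n) u v"
proof -
  have "\<exists>k<n. \<exists>b. pres_eq (I2_relations n) w (I2_normal k b)" for w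
    by (meson I2_normal_form[OF n] I2_normal_less[OF n] pres_trans)
  then obtain k b l c where k: "k < n" "pres_eq (I2_relations n) u (I2_normal k b)"
    and l: "l < n" "pres_eq (I2_relations n) v (I2_normal l c)"
    by metis
  have "int n dvd fst (I2_eval u) - int k" "snd (I2_eval u) = b"
    "int n dvd fst (I2_eval v) - int l" "snd (I2_eval v) = c"
    using I2_eval_cong[OF k(2)] I2_eval_cong[OF l(2)] by (simp_all add: I2_eval_normal)
  then have "int k mod int n = int l mod int n" "b = c"
    using assms(2,3) by (metis mod_eq_dvd_iff)+
  then have "I2_normal k b = I2_normal l c"
    using k(1) l(1) by simp
  then show ?thesis using k(2) l(2) by (metis pres_sym pres_trans)
qed

lemma I2_dichotomy:
  assumes n: "n > 0" and y: "y \<in> carrier (I2 n)"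
  shows "y \<otimes>\<^bsub>I2 n\<^esub> y = \<one>\<^bsub>I2 n\<^esub> \<or>
    (\<forall>x\<in>carrier (I2 n). x \<otimes>\<^bsub>I2 n\<^esub> y = y \<otimes>\<^bsub>I2 n\<^esub> x \<or> y \<otimes>\<^bsub>I2 n\<^esub> x \<otimes>\<^bsub>I2 n\<^esub> y = x)"
proof -
  obtain v where v: "y = pres_class (I2_relations n) v"
    using y by (auto simp: I2_def presented_group_carrier)
  show ?thesis
  \<comment> \<open>The flag marks reflections. For a reflection the exponents in
    \<open>v @ v\<close> cancel.\<close>
  proof (cases "snd (I2_eval v)")
    case True
    then have "pres_eq (I2_relations n) (v @ v) []"
      by (intro I2_eval_complete[OF n]) (auto simp: I2_eval_append)
    then show ?thesis
      by (simp add: v I2_def presented_group_mult presented_group_one pres_class_eq_iff)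
  next
    case False
    \<comment> \<open>With \<open>v\<close> a rotation of exponent \<open>a\<close>: rotations
      \<open>u\<close> commute with it, and a reflection \<open>u\<close> of exponent
      \<open>b\<close> gives \<open>a + b - a = b\<close> for \<open>v @ u @ v\<close>.\<close>
    then have "pres_eq (I2_relations n) (u @ v) (v @ u) \<or> pres_eq (I2_relations n) (v @ u @ v) u" for u
      by (cases "snd (I2_eval u)") (auto intro!: I2_eval_complete[OF n] simp: I2_eval_append)
    then show ?thesis
      by (auto simp: v I2_def presented_group_carrier presented_group_mult pres_class_eq_iff)
  qed
qed

section \<open>Unions of dihedral conjugacy classes\<close>

theorem theorem3p3:
  fixes n :: nat and \<C> :: "I2_gen word set set set"
  assumes "n \<ge> 1"
    and "\<C> \<subseteq> conjugacy_classes (I2 n)"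
  shows "hayashi_property (Conj (I2 n) (\<Union>\<C>))"
proof -
  interpret group "I2 n" by (rule group_I2)
  have C: "\<Union>\<C> \<subseteq> carrier (I2 n)"
    using assms(2) by (force simp: conjugacy_classes_def conjugacy_class_def)
  have closed: "g \<otimes>\<^bsub>I2 n\<^esub> x \<otimes>\<^bsub>I2 n\<^esub> inv\<^bsub>I2 n\<^esub> g \<in> \<Union>\<C>"
    if "g \<in> carrier (I2 n)" "x \<in> \<Union>\<C>" for g x
  proof -
    obtain c where "c \<in> \<C>" "x \<in> c" using \<open>x \<in> \<Union>\<C>\<close> by blast
    moreover from this obtain a where "a \<in> carrier (I2 n)" "c = conjugacy_class (I2 n) a"
      using assms(2) by (auto simp: conjugacy_classes_def)
    ultimately show ?thesis using conj_mem_conjugacy_class that(1) by blast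
  qed
  \<comment> \<open>Infinite sets have \<open>card\<close> 0, so the positive order
    \<open>2 * n\<close> yields finiteness.\<close>
  have "finite (carrier (I2 n))"
    using order_I2[of n] assms(1) by (simp add: order_def card_ge_0_finite)
  then have fin: "finite (\<Union>\<C>)" using C by (rule finite_subset[rotated])
  have "regular_permutation (\<Union>\<C>) (right_translation (Conj (I2 n) (\<Union>\<C>)) y)"
    if "y \<in> \<Union>\<C>" for y
  proof (rule regular_right_translation[OF C fin closed])
    show y: "y \<in> carrier (I2 n)" using that C by blast
    show "y \<otimes>\<^bsub>I2 n\<^esub> y = \<one>\<^bsub>I2 n\<^esub> \<or>
      (\<forall>x\<in>\<Union>\<C>. x \<otimes>\<^bsub>I2 n\<^esub> y = y \<otimes>\<^bsub>I2 n\<^esub> x \<or> y \<otimes>\<^bsub>I2 n\<^esub> x \<otimes>\<^bsub>I2 n\<^esub> y = x)"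
      using I2_dichotomy[of n y] y assms(1) C by auto
  qed
  then show ?thesis
    using quandle_Conj[OF C closed] fin unfolding hayashi_property_def by (simp add: Conj_def)
qed

end
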